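(* Let $A$ be a nonempty set, $\mathbb{F}$ a field, and $\mathscr{N}[A]$ the free non-associative $\mathbb{F}$-algebra on $A$. Let $S$ be a subalgebra of $\mathscr{N}[A]$, and let $\alpha_S \subset S$ be a set of nonzero $A$-polynomials such that $$\alpha_{S'} = \{\pi_{\deg(p)}(p) : p \in \alpha_S\}$$ is algebraically independent and $$\pi_{\deg(p_1)}(p_1) \neq \pi_{\deg(p_2)}(p_2)$$ for all $p_1, p_2 \in \alpha_S$ with $p_1 \neq p_2$. If $\alpha_S$ is of bounded degree and such that $$\{p \in S : \deg(p) \leq \deg(\alpha_S)\} \subset \langle \alpha_S \rangle,$$ then there exists an algebraically independent set $\alpha \subset S$ such that $$\alpha_S \subset \alpha \quad\text{and}\quad \langle \alpha \rangle = S.$$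
   Context: An $\mathbb{F}$-algebra is an $\mathbb{F}$-vector space with a bilinear product (not assumed associative, commutative or unital). $\mathscr{M}[A]$ is the free magma on $A$; its elements are called $A$-monomials. The degree of an $A$-monomial is the positive integer determined by $\deg(a)=1$ for $a\in A$ and $\deg((m_1,m_2))=\deg(m_1)+\deg(m_2)$, where $(m_1,m_2)$ denotes the product. $\mathscr{N}[A]$ is the $\mathbb{F}$-vector space with basis $\mathscr{M}[A]$ with the bilinear product extending that of $\mathscr{M}[A]$; its elements are called $A$-polynomials. The degree $\deg(p)$ of a nonzero $A$-polynomial $p$ is the largest degree of an $A$-monomial occurring in $p$ with nonzero coefficient; the degree of $0$ is undefined. $\mathscr{H}_n[A]$ is the span of the $A$-monomials of degree $n$, so $\mathscr{N}[A]=\bigoplus_{n\ge1}\mathscr{H}_n[A]$, and $\pi_n:\mathscr{N}[A]\to\mathscr{H}_n[A]$ is the canonical projection; thus $\pi_{\deg(p)}(p)$ is the highest-degree nonzero homogeneous component of a nonzero $p$. For indeterminates $X_1,\dots,X_n$, elements of $\mathscr{N}[X_1,\dots,X_n]$ (the free non-associative $\mathbb{F}$-algebra on $\{X_1,\dots,X_n\}$) are called polynomials. For elements $y_1,\dots,y_n$ of an $\mathbb{F}$-algebra $\mathscr{A}$, $P(y_1,\dots,y_n)$ is the image of $P$ under the unique algebra homomorphism $\mathscr{N}[X_1,\dots,X_n]\to\mathscr{A}$ with $X_i\mapsto y_i$. A subset $\alpha\subset\mathscr{A}$ is algebraically independent if for every $n \geq 1$, all distinct $y_1,\dots,y_n\in\alpha$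 and every $P\in\mathscr{N}[X_1,\dots,X_n]$, $P(y_1,\dots,y_n)=0$ implies $P=0$. $\langle G\rangle$ denotes the subalgebra generated by $G$ (so $\langle\emptyset\rangle=\{0\}$). A subset $T$ of $\mathscr{N}[A]$ is of bounded degree if there is a positive integer $N$ with $\deg(p)\le N$ for all nonzero $p\in T$. If $T$ is nonempty and of bounded degree, $\deg(T)$ denotes the smallest such $N$; $\deg(\emptyset)=0$. *)

theory Defs
  imports Complex_Main "HOL-Library.Poly_Mapping"
begin

datatype (gens: 'a) magma = Gen 'a | Mul "'a magma" "'a magma"

primrec monomial_degree :: "'a magma \<Rightarrow> nat" where
  "monomial_degree (Gen a) = 1"
| "monomial_degree (Mul m n) = monomial_degree m + monomial_degree n"

text \<open>
  The free non-associative algebra is the type of finitely supported functions from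
  the free magma to the field.  The multiplication supplied by \<^theory>\<open>HOL-Library.Poly_Mapping\<close> requires
  an associative unital structure on the exponents, so the free product is defined here.
\<close>

definition fscale :: "'f::field \<Rightarrow> ('a magma \<Rightarrow>\<^sub>0 'f) \<Rightarrow> ('a magma \<Rightarrow>\<^sub>0 'f)" where
  "fscale c p = Poly_Mapping.map ((*) c) p"

definition fmult :: "('a magma \<Rightarrow>\<^sub>0 'f::field) \<Rightarrow> ('a magma \<Rightarrow>\<^sub>0 'f) \<Rightarrow> ('a magma \<Rightarrow>\<^sub>0 'f)" where
  "fmult p q = (\<Sum>m\<in>Poly_Mapping.keys p. \<Sum>n\<in>Poly_Mapping.keys q.
     Poly_Mapping.single (Mul m n) (Poly_Mapping.lookup p m * Poly_Mapping.lookup q n))"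

definition free_algebra :: "'a set \<Rightarrow> ('a magma \<Rightarrow>\<^sub>0 'f::field) set" where
  "free_algebra A = {p. \<forall>m\<in>Poly_Mapping.keys p. gens m \<subseteq> A}"

text \<open>Only meaningful for nonzero polynomials.\<close>

definition poly_degree :: "('a magma \<Rightarrow>\<^sub>0 'f::field) \<Rightarrow> nat" where
  "poly_degree p = Max (monomial_degree ` Poly_Mapping.keys p)"

definition homogeneous_component :: "nat \<Rightarrow> ('a magma \<Rightarrow>\<^sub>0 'f::field) \<Rightarrow> ('a magma \<Rightarrow>\<^sub>0 'f)" where
  "homogeneous_component n p = Poly_Mapping.mapp (\<lambda>m c. if monomial_degree m = n then c else 0) p"

definition leading_component :: "('a magma \<Rightarrow>\<^sub>0 'f::field) \<Rightarrow> ('a magma \<Rightarrow>\<^sub>0 'f)" where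
  "leading_component p = homogeneous_component (poly_degree p) p"

definition degree_bound :: "('a magma \<Rightarrow>\<^sub>0 'f::field) set \<Rightarrow> nat \<Rightarrow> bool" where
  "degree_bound T N \<longleftrightarrow> 0 < N \<and> (\<forall>p\<in>T. p \<noteq> 0 \<longrightarrow> poly_degree p \<le> N)"

definition bounded_degree :: "('a magma \<Rightarrow>\<^sub>0 'f::field) set \<Rightarrow> bool" where
  "bounded_degree T \<longleftrightarrow> (\<exists>N. degree_bound T N)"

definition set_degree :: "('a magma \<Rightarrow>\<^sub>0 'f::field) set \<Rightarrow> nat" where
  "set_degree T = (if T = {} then 0 else (LEAST N. degree_bound T N))"

locale nonassoc_algebra = vector_space scale
  for scale :: "'f::field \<Rightarrow> 'b::ab_group_add \<Rightarrow> 'b" (infixr \<open>*s\<close> 75) +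
  fixes mult :: "'b \<Rightarrow> 'b \<Rightarrow> 'b" (infixl \<open>\<odot>\<close> 70)
  assumes mult_add_left: "(x + y) \<odot> z = x \<odot> z + y \<odot> z"
    and mult_add_right: "x \<odot> (y + z) = x \<odot> y + x \<odot> z"
    and mult_scale_left: "(c *s x) \<odot> y = c *s (x \<odot> y)"
    and mult_scale_right: "x \<odot> (c *s y) = c *s (x \<odot> y)"
begin

definition subalgebra :: "'b set \<Rightarrow> bool" where
  "subalgebra B \<longleftrightarrow> subspace B \<and> (\<forall>x\<in>B. \<forall>y\<in>B. x \<odot> y \<in> B)"

definition generated :: "'b set \<Rightarrow> 'b set" where
  "generated G = subalgebra hull G"

primrec monomial_value :: "('x \<Rightarrow> 'b) \<Rightarrow> 'x magma \<Rightarrow> 'b" where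
  "monomial_value y (Gen x) = y x"
| "monomial_value y (Mul m n) = monomial_value y m \<odot> monomial_value y n"

text \<open>
  The algebra homomorphism extending \<open>y\<close>; the lemmas \<open>poly_value_linear\<close>, \<open>poly_value_fmult\<close>,
  \<open>poly_value_Gen\<close> and \<open>poly_value_unique\<close> below characterise it.
\<close>

definition poly_value :: "('x \<Rightarrow> 'b) \<Rightarrow> ('x magma \<Rightarrow>\<^sub>0 'f) \<Rightarrow> 'b" where
  "poly_value y P = (\<Sum>m\<in>Poly_Mapping.keys P. Poly_Mapping.lookup P m *s monomial_value y m)"

text \<open>The indeterminate \<open>X\<^sub>i\<close> is the generator \<open>i\<close>, for \<open>1 \<le> i \<le> n\<close>.\<close>

definition algebraically_independent :: "'b set \<Rightarrow> bool" where
  "algebraically_independent B \<longleftrightarrow>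
     (\<forall>n\<ge>1. \<forall>y::nat \<Rightarrow> 'b. y ` {1..n} \<subseteq> B \<and> inj_on y {1..n} \<longrightarrow>
        (\<forall>P\<in>free_algebra {1..n}. poly_value y P = 0 \<longrightarrow> P = 0))"

end

lemma lookup_fscale: "Poly_Mapping.lookup (fscale c p) m = c * Poly_Mapping.lookup p m"
  unfolding fscale_def by (simp add: map.rep_eq when_def)

lemma lookup_fmult_Gen: "Poly_Mapping.lookup (fmult p q) (Gen a) = 0"
  by (simp add: fmult_def lookup_sum lookup_single)

lemma lookup_fmult_Mul:
  "Poly_Mapping.lookup (fmult p q) (Mul m n) = Poly_Mapping.lookup p m * Poly_Mapping.lookup q n"
proof -
  let ?c = "\<lambda>i j. Poly_Mapping.lookup p i * Poly_Mapping.lookup q j"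
  have "Poly_Mapping.lookup (fmult p q) (Mul m n) =
      (\<Sum>i\<in>Poly_Mapping.keys p. \<Sum>j\<in>Poly_Mapping.keys q. if i = m \<and> j = n then ?c m n else 0)"
    by (auto simp: fmult_def lookup_sum lookup_single when_def intro!: sum.cong)
  also have "\<dots> = (\<Sum>i\<in>Poly_Mapping.keys p. if i = m then
      (\<Sum>j\<in>Poly_Mapping.keys q. if j = n then ?c m n else 0) else 0)"
    by (intro sum.cong) auto
  also have "\<dots> = ?c m n"
    by (auto simp: in_keys_iff)
  finally show ?thesis .
qed

lemma fmult_eqI:
  assumes "\<And>a. Poly_Mapping.lookup p (Gen a) = Poly_Mapping.lookup q (Gen a)"
    and "\<And>m n. Poly_Mapping.lookup p (Mul m n) = Poly_Mapping.lookup q (Mul m n)"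
  shows "p = q"
proof (rule poly_mapping_eqI)
  show "Poly_Mapping.lookup p k = Poly_Mapping.lookup q k" for k
    using assms by (cases k) auto
qed

lemma lookup_homogeneous_component:
  "Poly_Mapping.lookup (homogeneous_component n p) m =
     (if monomial_degree m = n then Poly_Mapping.lookup p m else 0)"
  by (auto simp: homogeneous_component_def lookup_mapp when_def in_keys_iff)

global_interpretation free: nonassoc_algebra
  "fscale :: 'f::field \<Rightarrow> ('a magma \<Rightarrow>\<^sub>0 'f) \<Rightarrow> ('a magma \<Rightarrow>\<^sub>0 'f)" fmult
proof
  fix c d :: 'f and x y z :: "'a magma \<Rightarrow>\<^sub>0 'f"
  show "fscale c (x + y) = fscale c x + fscale c y"
    "fscale (c + d) x = fscale c x + fscale d x"
    "fscale c (fscale d x) = fscale (c * d) x"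
    "fscale 1 x = x"
    by (rule poly_mapping_eqI, simp add: lookup_fscale lookup_add algebra_simps)+
  show "fmult (x + y) z = fmult x z + fmult y z"
    "fmult x (y + z) = fmult x y + fmult x z"
    "fmult (fscale c x) y = fscale c (fmult x y)"
    "fmult x (fscale c y) = fscale c (fmult x y)"
    by (rule fmult_eqI;
        simp add: lookup_fmult_Gen lookup_fmult_Mul lookup_fscale lookup_add algebra_simps)+
qed

lemma fmult_single:
  "fmult (Poly_Mapping.single m c) (Poly_Mapping.single n d) = Poly_Mapping.single (Mul m n) (c * d)"
  by (rule fmult_eqI) (auto simp: lookup_fmult_Gen lookup_fmult_Mul lookup_single when_def)

lemma free_algebra_subalgebra:
  "free.subalgebra (free_algebra A :: ('a magma \<Rightarrow>\<^sub>0 'f::field) set)"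
proof -
  have "x + y \<in> free_algebra A" if "x \<in> free_algebra A" "y \<in> free_algebra A"
    for x y :: "'a magma \<Rightarrow>\<^sub>0 'f"
    using that keys_add[of x y] by (auto simp: free_algebra_def)
  moreover have "fscale c x \<in> free_algebra A" if "x \<in> free_algebra A"
    for c and x :: "'a magma \<Rightarrow>\<^sub>0 'f"
    using that by (auto simp: free_algebra_def in_keys_iff lookup_fscale)
  moreover have "fmult x y \<in> free_algebra A"
    if "x \<in> free_algebra A" "y \<in> free_algebra A" for x y :: "'a magma \<Rightarrow>\<^sub>0 'f"
  proof -
    have "gens k \<subseteq> A" if "k \<in> Poly_Mapping.keys (fmult x y)" for k
      using that \<open>x \<in> _\<close> \<open>y \<in> _\<close>
      by (cases k) (auto simp: free_algebra_def in_keys_iff lookup_fmult_Gen lookup_fmult_Mul)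
    then show ?thesis by (auto simp: free_algebra_def)
  qed
  moreover have "(0 :: 'a magma \<Rightarrow>\<^sub>0 'f) \<in> free_algebra A"
    by (simp add: free_algebra_def)
  ultimately show ?thesis
    by (simp add: free.subalgebra_def free.subspace_def)
qed

lemma free_algebra_UNIV: "free_algebra UNIV = UNIV"
  by (simp add: free_algebra_def)

context nonassoc_algebra
begin

lemma poly_value_superset:
  assumes "finite K" "Poly_Mapping.keys P \<subseteq> K"
  shows "poly_value y P = (\<Sum>m\<in>K. Poly_Mapping.lookup P m *s monomial_value y m)"
  unfolding poly_value_def using assms
  by (intro sum.mono_neutral_left) (auto simp: in_keys_iff)

lemma poly_value_add: "poly_value y (P + Q) = poly_value y P + poly_value y Q"
proof -
  let ?K = "Poly_Mapping.keys P \<union> Poly_Mapping.keys Q"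
  have "Poly_Mapping.keys (P + Q) \<subseteq> ?K" by (rule keys_add)
  then show ?thesis
    by (simp add: poly_value_superset[of ?K] lookup_add scale_left_distrib sum.distrib)
qed

lemma poly_value_fscale: "poly_value y (fscale c P) = c *s poly_value y P"
proof -
  have "Poly_Mapping.keys (fscale c P) \<subseteq> Poly_Mapping.keys P"
    by (auto simp: in_keys_iff lookup_fscale)
  then show ?thesis
    by (simp add: poly_value_superset[of "Poly_Mapping.keys P"] lookup_fscale scale_sum_right)
qed

lemma poly_value_linear: "Vector_Spaces.linear fscale scale (poly_value y)"
  by unfold_locales (simp_all add: poly_value_add poly_value_fscale)

lemma poly_value_single: "poly_value y (Poly_Mapping.single m c) = c *s monomial_value y m"
  by (subst poly_value_superset[of "{m}"]) auto

lemma poly_value_Gen: "poly_value y (Poly_Mapping.single (Gen x) 1) = y x"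
  by (simp add: poly_value_single)

lemma single_expansion:
  "P = (\<Sum>m\<in>Poly_Mapping.keys P. fscale (Poly_Mapping.lookup P m) (Poly_Mapping.single m 1))"
  by (rule poly_mapping_eqI) (simp add: lookup_sum lookup_fscale lookup_single when_def in_keys_iff
      if_distrib[of "\<lambda>x. _ * x"] cong: if_cong)

lemma mult_sum_left: "(\<Sum>i\<in>I. f i) \<odot> x = (\<Sum>i\<in>I. f i \<odot> x)"
proof -
  have "0 \<odot> x = 0" using mult_scale_left[of 0 0 x] by simp
  then show ?thesis by (induction I rule: infinite_finite_induct) (auto simp: mult_add_left)
qed

lemma mult_sum_right: "x \<odot> (\<Sum>i\<in>I. f i) = (\<Sum>i\<in>I. x \<odot> f i)"
proof -
  have "x \<odot> 0 = 0" using mult_scale_right[of x 0 0] by simp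
  then show ?thesis by (induction I rule: infinite_finite_induct) (auto simp: mult_add_right)
qed

lemma poly_value_sum: "poly_value y (\<Sum>i\<in>I. f i) = (\<Sum>i\<in>I. poly_value y (f i))"
  by (induction I rule: infinite_finite_induct) (auto simp: poly_value_add poly_value_def[of _ 0])

lemma poly_value_fmult: "poly_value y (fmult P Q) = poly_value y P \<odot> poly_value y Q"
proof -
  have "poly_value y (fmult P Q) =
      (\<Sum>m\<in>Poly_Mapping.keys P. \<Sum>n\<in>Poly_Mapping.keys Q.
        (Poly_Mapping.lookup P m * Poly_Mapping.lookup Q n) *s monomial_value y (Mul m n))"
    by (simp add: fmult_def poly_value_sum poly_value_single)
  also have "\<dots> = poly_value y P \<odot> poly_value y Q"
    by (simp add: poly_value_def mult_sum_left mult_sum_right mult_scale_left mult_scale_right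
        scale_sum_right mult.commute, rule sum.swap)
  finally show ?thesis .
qed

lemma poly_value_unique:
  assumes "Vector_Spaces.linear fscale scale h"
    and mult: "\<And>P Q. h (fmult P Q) = h P \<odot> h Q"
    and gen: "\<And>x. h (Poly_Mapping.single (Gen x) 1) = y x"
  shows "h = poly_value y"
proof
  fix P
  interpret h: Vector_Spaces.linear fscale scale h by fact
  have single: "h (Poly_Mapping.single m 1) = monomial_value y m" for m
  proof (induction m)
    case (Mul m n)
    then show ?case using mult[of "Poly_Mapping.single m 1" "Poly_Mapping.single n 1"]
      by (simp add: fmult_single)
  qed (simp add: gen)
  have "h P = h (\<Sum>m\<in>Poly_Mapping.keys P. fscale (Poly_Mapping.lookup P m) (Poly_Mapping.single m 1))"
    using single_expansion[of P] by simp
  also have "\<dots> = poly_value y P"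
    by (simp add: h.sum h.scale single poly_value_def)
  finally show "h P = poly_value y P" .
qed

end

end

theory Submission
  imports Defs
begin

text \<open>
  The argument passes from the subalgebra \<open>S\<close> to its associated graded object.  Let \<open>L\<^sub>n\<close>
  (\<open>initial_part S n\<close>) be the space of degree-\<open>n\<close> components of elements of \<open>S\<close> of degree at most \<open>n\<close>,
  and let \<open>D\<^sub>n \<subseteq> L\<^sub>n\<close> be spanned by the products of elements of \<open>L\<^sub>i\<close> and \<open>L\<^sub>j\<close> with \<open>i + j = n\<close> and
  \<open>i, j > 0\<close>.  Consider a set \<open>B \<subseteq> S\<close> of nonzero polynomials such that, for every \<open>n\<close>, the leading
  components of its elements of degree \<open>n\<close> form a basis of \<open>L\<^sub>n\<close> modulo \<open>D\<^sub>n\<close>.  Then \<open>B\<close> is a free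
  generating set of \<open>S\<close>, and the two halves of ``basis'' serve separate purposes.

  Spanning (\<open>exhausting\<close>) gives generation: by induction on the degree, an element of \<open>S\<close> can be
  corrected by an element of the generated subalgebra so that its degree drops.

  Independence modulo \<open>D\<^sub>n\<close> (\<open>reduced\<close>) gives algebraic independence.  In a relation of weight \<open>n\<close>
  between the leading components, the linear part must vanish, so that only products remain.  In a
  free non-associative algebra every monomial other than a generator factors in exactly one way, so
  multiplication is injective on the tensor square (\<open>fmult_tensor_injective\<close>), and the relation splits
  into relations of smaller weight.  The polynomials of \<open>B\<close> themselves inherit independence from their
  leading components, because the part of top weight of a relation would be a relation between the
  leading components (\<open>poly_value_top_weight\<close>).

  It remains to extend the given set to such a \<open>B\<close>.  In degrees above its degree bound \<open>N\<close> the given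
  set has no elements, and one lifts an arbitrary basis of \<open>L\<^sub>n\<close> modulo \<open>D\<^sub>n\<close> to \<open>S\<close>
  (\<open>reduced_exhausting_extension\<close>).  In degrees up to \<open>N\<close> the given set already provides such a
  basis: since it generates all elements of \<open>S\<close> of degree at most \<open>N\<close> and no cancellation of leading
  components can occur, each \<open>L\<^sub>n\<close> consists of the values of polynomials of weight \<open>n\<close> at the leading
  components (\<open>initial_part_spanned\<close>, \<open>reduced_of_independent\<close>).
\<close>

section \<open>Substitution and algebraic independence\<close>

lemma gens_nonempty: "gens m \<noteq> {}"
  by (induction m) auto

context nonassoc_algebra
begin

lemma subalgebra_generated: "subalgebra (generated G)"
  unfolding generated_def
  by (rule hull_in) (auto simp: subalgebra_def subspace_def)

lemma generated_minimal: "G \<subseteq> C \<Longrightarrow> subalgebra C \<Longrightarrow> generated G \<subseteq> C"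
  unfolding generated_def by (rule hull_minimal)

lemma generated_superset: "G \<subseteq> generated G"
  unfolding generated_def by (rule hull_subset)

lemma monomial_value_in_subalgebra:
  assumes "subalgebra C" "gens m \<subseteq> X" "\<And>x. x \<in> X \<Longrightarrow> y x \<in> C"
  shows "monomial_value y m \<in> C"
  using assms(2) by (induction m) (use assms(1,3) in \<open>auto simp: subalgebra_def\<close>)

lemma poly_value_in_subalgebra:
  assumes "subalgebra C" "P \<in> free_algebra X" "\<And>x. x \<in> X \<Longrightarrow> y x \<in> C"
  shows "poly_value y P \<in> C"
proof -
  have "subspace C" using assms(1) by (simp add: subalgebra_def)
  moreover have "monomial_value y m \<in> C" if "m \<in> Poly_Mapping.keys P" for m
    using that assms(2) by (intro monomial_value_in_subalgebra[OF assms(1) _ assms(3)])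
      (auto simp: free_algebra_def)
  ultimately show ?thesis
    unfolding poly_value_def by (intro subspace_sum subspace_scale)
qed

lemma monomial_value_cong:
  assumes "\<And>x. x \<in> gens m \<Longrightarrow> y x = z x"
  shows "monomial_value y m = monomial_value z m"
  using assms by (induction m) auto

lemma poly_value_cong:
  assumes "P \<in> free_algebra X" "\<And>x. x \<in> X \<Longrightarrow> y x = z x"
  shows "poly_value y P = poly_value z P"
  unfolding poly_value_def
proof (rule sum.cong[OF refl])
  fix m assume "m \<in> Poly_Mapping.keys P"
  then have "gens m \<subseteq> X" using assms(1) by (auto simp: free_algebra_def)
  then have "monomial_value y m = monomial_value z m"
    using assms(2) by (intro monomial_value_cong) auto
  then show "Poly_Mapping.lookup P m *s monomial_value y m =
      Poly_Mapping.lookup P m *s monomial_value z m" by simp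
qed

lemma poly_value_0: "poly_value y 0 = 0"
  by (simp add: poly_value_def)

lemma poly_value_diff: "poly_value y (P - Q) = poly_value y P - poly_value y Q"
  using poly_value_add[of y "P - Q" Q] by (simp add: algebra_simps)

lemma generated_subset_poly_values:
  "generated G \<subseteq> poly_value (\<lambda>x. x) ` free_algebra G"
proof (rule generated_minimal)
  show "G \<subseteq> poly_value (\<lambda>x. x) ` free_algebra G"
  proof
    fix g assume "g \<in> G"
    then have "Poly_Mapping.single (Gen g) 1 \<in> (free_algebra G :: ('b magma \<Rightarrow>\<^sub>0 'f) set)"
      by (simp add: free_algebra_def)
    then show "g \<in> poly_value (\<lambda>x. x) ` free_algebra G"
      using poly_value_Gen[of "\<lambda>x. x" g] by (metis image_eqI)
  qed
  have sub: "free.subalgebra (free_algebra G :: ('b magma \<Rightarrow>\<^sub>0 'f) set)"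
    by (rule free_algebra_subalgebra)
  show "subalgebra (poly_value (\<lambda>x. x) ` free_algebra G)"
    unfolding subalgebra_def subspace_def
  proof (intro conjI ballI allI)
    show "0 \<in> poly_value (\<lambda>x. x) ` free_algebra G"
      by (rule image_eqI[of _ _ 0]) (simp_all add: poly_value_0 free_algebra_def)
  next
    fix a b assume "a \<in> poly_value (\<lambda>x. x) ` free_algebra G" "b \<in> poly_value (\<lambda>x. x) ` free_algebra G"
    then obtain P Q where "P \<in> free_algebra G" "Q \<in> free_algebra G"
      "a = poly_value (\<lambda>x. x) P" "b = poly_value (\<lambda>x. x) Q" by blast
    moreover from this have "P + Q \<in> free_algebra G" "fmult P Q \<in> free_algebra G"
      using sub unfolding free.subalgebra_def free.subspace_def by blast+
    ultimately show "a + b \<in> poly_value (\<lambda>x. x) ` free_algebra G"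
      "a \<odot> b \<in> poly_value (\<lambda>x. x) ` free_algebra G"
      by (simp_all add: poly_value_add[symmetric] poly_value_fmult[symmetric])
  next
    fix c a assume "a \<in> poly_value (\<lambda>x. x) ` free_algebra G"
    then obtain P where "P \<in> free_algebra G" "a = poly_value (\<lambda>x. x) P" by blast
    moreover from this have "fscale c P \<in> free_algebra G"
      using sub unfolding free.subalgebra_def free.subspace_def by blast
    ultimately show "c *s a \<in> poly_value (\<lambda>x. x) ` free_algebra G"
      by (simp add: poly_value_fscale[symmetric])
  qed
qed

end

text \<open>
  Renaming of indeterminates, seen as a substitution, so that its interaction with \<open>poly_value\<close> is an
  instance of composing homomorphisms.
\<close>

definition relabel :: "('x \<Rightarrow> 'y) \<Rightarrow> ('x magma \<Rightarrow>\<^sub>0 'f::field) \<Rightarrow> ('y magma \<Rightarrow>\<^sub>0 'f)" where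
  "relabel g = free.poly_value (\<lambda>x. Poly_Mapping.single (Gen (g x)) 1)"

lemma relabel_in_free_algebra:
  "P \<in> free_algebra X \<Longrightarrow> g ` X \<subseteq> Y \<Longrightarrow> relabel g P \<in> free_algebra Y"
  unfolding relabel_def
  by (rule free.poly_value_in_subalgebra[OF free_algebra_subalgebra])
    (auto simp: free_algebra_def)

lemma relabel_id: "relabel (\<lambda>x. x) P = (P :: 'a magma \<Rightarrow>\<^sub>0 'f::field)"
proof -
  have "free.monomial_value (\<lambda>x. Poly_Mapping.single (Gen x) 1) m = Poly_Mapping.single m (1::'f)"
    for m :: "'a magma"
    by (induction m) (auto simp: fmult_single)
  then show ?thesis
    using free.single_expansion[of P, symmetric] by (simp add: relabel_def free.poly_value_def)
qed

context nonassoc_algebra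
begin

lemma poly_value_relabel: "poly_value y (relabel g P) = poly_value (\<lambda>x. y (g x)) P"
proof -
  have "poly_value y (free.monomial_value (\<lambda>x. Poly_Mapping.single (Gen (g x)) 1) m) =
      monomial_value (\<lambda>x. y (g x)) m" for m
    by (induction m) (auto simp: poly_value_Gen poly_value_fmult)
  then show ?thesis
    by (simp add: relabel_def free.poly_value_def poly_value_sum poly_value_fscale)
      (simp add: poly_value_def)
qed

end

lemma relabel_relabel: "relabel h (relabel g P) = relabel (\<lambda>x. h (g x)) P"
  using free.poly_value_relabel[of _ g P] by (simp add: relabel_def)

lemma relabel_cong:
  "P \<in> free_algebra X \<Longrightarrow> (\<And>x. x \<in> X \<Longrightarrow> g x = h x) \<Longrightarrow> relabel g P = relabel h P"
  unfolding relabel_def by (rule free.poly_value_cong) auto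

lemma relabel_eq_0:
  assumes "P \<in> free_algebra X" "inj_on g X" "relabel g P = 0"
  shows "P = 0"
proof -
  have "P = relabel (\<lambda>x. inv_into X g (g x)) P"
    using relabel_cong[OF assms(1), of "\<lambda>x. inv_into X g (g x)" "\<lambda>x. x"] assms(2)
    by (simp add: relabel_id)
  also have "\<dots> = relabel (inv_into X g) (relabel g P)"
    by (simp add: relabel_relabel)
  finally show ?thesis
    by (simp add: assms(3)) (simp add: relabel_def free.poly_value_0)
qed

context nonassoc_algebra
begin

text \<open>
  A relation involves only finitely many indeterminates, so the numbered indeterminates in the definition
  of independence can be replaced by the elements of any set \<open>B\<close> that indexes the family injectively.  With
  \<open>y\<close> the identity or \<open>leading_component\<close>, relations between polynomials and relations between their
  leading components become statements about one and the same algebra of formal polynomials.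
\<close>

lemma algebraically_independent_image_iff:
  assumes inj: "inj_on y B"
  shows "algebraically_independent (y ` B) \<longleftrightarrow>
    (\<forall>P\<in>free_algebra B. poly_value y P = 0 \<longrightarrow> P = 0)"
proof
  assume ind: "algebraically_independent (y ` B)"
  show "\<forall>P\<in>free_algebra B. poly_value y P = 0 \<longrightarrow> P = 0"
  proof (intro ballI impI)
    fix P :: "_ magma \<Rightarrow>\<^sub>0 'f"
    assume P: "P \<in> free_algebra B" "poly_value y P = 0"
    define G where "G = \<Union> (gens ` Poly_Mapping.keys P)"
    have GB: "G \<subseteq> B" and PG: "P \<in> free_algebra G"
      using P(1) by (auto simp: G_def free_algebra_def)
    have "finite (gens m)" for m :: "'c magma" by (induction m) auto
    then have "finite G" by (simp add: G_def)
    then obtain e where e: "bij_betw e {1..card G} G"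
      using ex_bij_betw_nat_finite_1 by blast
    let ?i = "inv_into {1..card G} e"
    show "P = 0"
    proof (cases "G = {}")
      case True
      then have "m \<notin> Poly_Mapping.keys P" for m
        using gens_nonempty[of m] by (auto simp: G_def)
      then show ?thesis by (intro poly_mapping_eqI) (simp add: in_keys_iff)
    next
      case False
      have i: "bij_betw ?i G {1..card G}" using e by (rule bij_betw_inv_into)
      have 1: "relabel ?i P \<in> free_algebra {1..card G}"
        using bij_betw_imp_surj_on[OF i] by (intro relabel_in_free_algebra[OF PG]) simp
      have "poly_value (\<lambda>k. y (e k)) (relabel ?i P) = poly_value (\<lambda>x. y (e (?i x))) P"
        using poly_value_relabel[of "\<lambda>k. y (e k)" ?i P] by simp
      also have "\<dots> = poly_value y P"
        by (intro poly_value_cong[OF PG]) (simp only: bij_betw_inv_into_right[OF e])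
      finally have 2: "poly_value (\<lambda>k. y (e k)) (relabel ?i P) = 0" using P(2) by simp
      have "e ` {1..card G} \<subseteq> B"
        using bij_betw_imp_surj_on[OF e] GB by simp
      then have 3: "(\<lambda>k. y (e k)) ` {1..card G} \<subseteq> y ` B" by auto
      have 4: "inj_on (\<lambda>k. y (e k)) {1..card G}"
        using comp_inj_on[OF bij_betw_imp_inj_on[OF e] inj_on_subset[OF inj \<open>e ` _ \<subseteq> B\<close>]]
        by (simp add: comp_def)
      have "card G \<ge> 1" using False \<open>finite G\<close> by (simp add: Suc_leI card_gt_0_iff)
      then have "relabel ?i P = 0"
        using ind[unfolded algebraically_independent_def, rule_format, OF _ conjI[OF 3 4] 1 2] by simp
      then show ?thesis
        using relabel_eq_0[OF PG bij_betw_imp_inj_on[OF i]] by simp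
    qed
  qed
next
  assume ind: "\<forall>P\<in>free_algebra B. poly_value y P = 0 \<longrightarrow> P = 0"
  show "algebraically_independent (y ` B)"
    unfolding algebraically_independent_def
  proof (intro allI impI ballI)
    fix n :: nat and z and P :: "nat magma \<Rightarrow>\<^sub>0 'f"
    assume z: "z ` {1..n} \<subseteq> y ` B \<and> inj_on z {1..n}"
      and P: "P \<in> free_algebra {1..n}" "poly_value z P = 0"
    let ?g = "\<lambda>k. inv_into B y (z k)"
    have yg: "y (?g k) = z k" and gB: "?g k \<in> B" if "k \<in> {1..n}" for k
    proof -
      have "z k \<in> y ` B" using z that by blast
      then show "y (?g k) = z k" "?g k \<in> B" by (simp_all add: f_inv_into_f inv_into_into)
    qed
    have "poly_value y (relabel ?g P) = poly_value z P"
      unfolding poly_value_relabel using yg by (rule poly_value_cong[OF P(1)])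
    moreover have "relabel ?g P \<in> free_algebra B"
      using gB by (intro relabel_in_free_algebra[OF P(1)]) auto
    ultimately have "relabel ?g P = 0" using ind P(2) by simp
    moreover have "inj_on ?g {1..n}"
    proof (rule inj_onI)
      fix k l assume "k \<in> {1..n}" "l \<in> {1..n}" "?g k = ?g l"
      then have "z k = z l" using yg by metis
      then show "k = l" using z \<open>k \<in> _\<close> \<open>l \<in> _\<close> by (meson inj_onD)
    qed
    ultimately show "P = 0" using relabel_eq_0[OF P(1)] by blast
  qed
qed

end

lemma free_algebraD: "P \<in> free_algebra B \<Longrightarrow> m \<in> Poly_Mapping.keys P \<Longrightarrow> gens m \<subseteq> B"
  by (simp add: free_algebra_def)

section \<open>The degree filtration\<close>

definition degree_le :: "nat \<Rightarrow> ('a magma \<Rightarrow>\<^sub>0 'f::field) set" where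
  "degree_le n = {p. \<forall>m\<in>Poly_Mapping.keys p. monomial_degree m \<le> n}"

lemma degree_leD: "p \<in> degree_le n \<Longrightarrow> n < monomial_degree m \<Longrightarrow> Poly_Mapping.lookup p m = 0"
  by (force simp: degree_le_def in_keys_iff)

lemma degree_leI:
  "(\<And>m. n < monomial_degree m \<Longrightarrow> Poly_Mapping.lookup p m = 0) \<Longrightarrow> p \<in> degree_le n"
  by (force simp: degree_le_def in_keys_iff not_le[symmetric])

lemma degree_le_mono: "i \<le> j \<Longrightarrow> degree_le i \<subseteq> degree_le j"
  by (auto simp: degree_le_def)

lemma monomial_degree_pos: "0 < monomial_degree m"
  by (induction m) auto

lemma degree_le_0: "degree_le 0 = {0}"
proof -
  have "p = 0" if "p \<in> degree_le 0" for p :: "'a magma \<Rightarrow>\<^sub>0 'f::field"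
    using degree_leD[OF that monomial_degree_pos] by (intro poly_mapping_eqI) simp
  then show ?thesis by (auto intro: degree_leI)
qed

lemma subspace_degree_le: "free.subspace (degree_le n)"
  by (auto simp: free.subspace_def lookup_add lookup_fscale degree_leD intro!: degree_leI)

lemma fmult_degree_le:
  assumes "p \<in> degree_le i" "q \<in> degree_le j"
  shows "fmult p q \<in> degree_le (i + j)"
proof (rule degree_leI)
  fix m :: "'a magma" assume m: "i + j < monomial_degree m"
  show "Poly_Mapping.lookup (fmult p q) m = 0"
  proof (cases m)
    case (Mul a b)
    then have "i < monomial_degree a \<or> j < monomial_degree b" using m by auto
    then show ?thesis using Mul assms by (auto simp: lookup_fmult_Mul degree_leD)
  qed (simp add: lookup_fmult_Gen)
qed

lemma degree_le_poly_degree: "p \<in> degree_le (poly_degree p)"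
  by (auto simp: degree_le_def poly_degree_def)

lemma poly_degree_le: "p \<in> degree_le n \<Longrightarrow> p \<noteq> 0 \<Longrightarrow> poly_degree p \<le> n"
  by (auto simp: degree_le_def poly_degree_def)

lemma poly_degree_pos: "p \<noteq> 0 \<Longrightarrow> 0 < poly_degree p"
  using degree_le_poly_degree[of p] by (cases "poly_degree p = 0") (auto simp: degree_le_0)

lemma homogeneous_component_add:
  "homogeneous_component n (p + q) = homogeneous_component n p + homogeneous_component n q"
  by (rule poly_mapping_eqI) (simp add: lookup_homogeneous_component lookup_add)

lemma homogeneous_component_fscale:
  "homogeneous_component n (fscale c p) = fscale c (homogeneous_component n p)"
  by (rule poly_mapping_eqI) (simp add: lookup_homogeneous_component lookup_fscale)

lemma homogeneous_component_0: "homogeneous_component n 0 = 0"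
  by (rule poly_mapping_eqI) (simp add: lookup_homogeneous_component)

lemma homogeneous_component_diff:
  "homogeneous_component n (p - q) = homogeneous_component n p - homogeneous_component n q"
  by (rule poly_mapping_eqI) (simp add: lookup_homogeneous_component lookup_minus)

lemma homogeneous_component_sum:
  "homogeneous_component n (\<Sum>i\<in>I. f i) = (\<Sum>i\<in>I. homogeneous_component n (f i))"
  by (induction I rule: infinite_finite_induct)
    (auto simp: homogeneous_component_add homogeneous_component_0)

lemma homogeneous_component_idem:
  "homogeneous_component n (homogeneous_component k p) =
    (if n = k then homogeneous_component k p else 0)"
  by (rule poly_mapping_eqI) (simp add: lookup_homogeneous_component)

lemma homogeneous_component_fmult:
  assumes "p \<in> degree_le i" "q \<in> degree_le j"
  shows "homogeneous_component (i + j) (fmult p q) =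
    fmult (homogeneous_component i p) (homogeneous_component j q)"
proof (rule fmult_eqI)
  fix a b
  show "Poly_Mapping.lookup (homogeneous_component (i + j) (fmult p q)) (Mul a b) =
      Poly_Mapping.lookup (fmult (homogeneous_component i p) (homogeneous_component j q)) (Mul a b)"
    using degree_leD[OF assms(1), of a] degree_leD[OF assms(2), of b]
    by (cases "monomial_degree a" i rule: linorder_cases)
      (auto simp: lookup_homogeneous_component lookup_fmult_Mul)
qed (simp add: lookup_homogeneous_component lookup_fmult_Gen)

lemma homogeneous_component_above:
  "p \<in> degree_le n \<Longrightarrow> n < k \<Longrightarrow> homogeneous_component k p = 0"
  by (rule poly_mapping_eqI) (simp add: lookup_homogeneous_component degree_leD)

lemma degree_le_pred:
  assumes "p \<in> degree_le n" "homogeneous_component n p = 0" 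
  shows "p \<in> degree_le (n - 1)"
proof (rule degree_leI)
  fix m :: "'a magma" assume "n - 1 < monomial_degree m"
  then have "monomial_degree m = n \<or> n < monomial_degree m" by auto
  then show "Poly_Mapping.lookup p m = 0"
    using degree_leD[OF assms(1)] assms(2) lookup_homogeneous_component[of n p m]
    by (metis lookup_zero)
qed

lemma poly_degree_eqI:
  assumes "p \<in> degree_le n" "homogeneous_component n p \<noteq> 0"
  shows "poly_degree p = n"
proof (rule antisym)
  have "p \<noteq> 0" using assms(2) homogeneous_component_0 by auto
  then show "poly_degree p \<le> n" using assms(1) by (rule poly_degree_le[rotated])
  show "n \<le> poly_degree p"
    using homogeneous_component_above[OF degree_le_poly_degree, of p n] assms(2) by force
qed

section \<open>Polynomials in polynomials, graded by weight\<close>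

text \<open>
  Here the indeterminates are the polynomials of the free algebra themselves.  An indeterminate counts
  with its degree, so a monomial takes at the leading components a homogeneous value whose degree is the
  weight of the monomial.
\<close>

primrec weight :: "('a magma \<Rightarrow>\<^sub>0 'f::field) magma \<Rightarrow> nat" where
  "weight (Gen p) = poly_degree p"
| "weight (Mul m n) = weight m + weight n"

definition weight_part ::
    "nat \<Rightarrow> (('a magma \<Rightarrow>\<^sub>0 'f::field) magma \<Rightarrow>\<^sub>0 'f) \<Rightarrow> (('a magma \<Rightarrow>\<^sub>0 'f) magma \<Rightarrow>\<^sub>0 'f)" where
  "weight_part n P = Poly_Mapping.mapp (\<lambda>m c. if weight m = n then c else 0) P"

lemma lookup_weight_part:
  "Poly_Mapping.lookup (weight_part n P) m = (if weight m = n then Poly_Mapping.lookup P m else 0)"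
  by (auto simp: weight_part_def lookup_mapp when_def in_keys_iff)

lemma keys_weight_part:
  "Poly_Mapping.keys (weight_part n P) = {m \<in> Poly_Mapping.keys P. weight m = n}"
  by (auto simp: in_keys_iff lookup_weight_part split: if_splits)

lemma weight_part_in_free_algebra: "P \<in> free_algebra B \<Longrightarrow> weight_part n P \<in> free_algebra B"
  by (auto simp: free_algebra_def keys_weight_part)

lemma weight_pos: "gens m \<subseteq> B \<Longrightarrow> 0 \<notin> B \<Longrightarrow> 0 < weight m"
  by (induction m) (auto intro: poly_degree_pos)

lemma monomial_value_degree_le: "free.monomial_value (\<lambda>p. p) m \<in> degree_le (weight m)"
  by (induction m) (auto intro: degree_le_poly_degree fmult_degree_le)

lemma monomial_value_leading_component:
  "free.monomial_value leading_component m =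
    homogeneous_component (weight m) (free.monomial_value (\<lambda>p. p) m)"
  by (induction m)
    (auto simp: leading_component_def homogeneous_component_fmult monomial_value_degree_le)

text \<open>
  Substituting leading components respects the gradings, so relations between leading components may be
  taken to be homogeneous.
\<close>

lemma homogeneous_component_poly_value_leading:
  "homogeneous_component n (free.poly_value leading_component P) =
    free.poly_value leading_component (weight_part n P)"
proof -
  let ?v = "free.monomial_value leading_component"
  have *: "homogeneous_component n (?v m) = (if weight m = n then ?v m else 0)" for m
    by (auto simp: monomial_value_leading_component homogeneous_component_idem)
  have "homogeneous_component n (free.poly_value leading_component P) =
      (\<Sum>m\<in>Poly_Mapping.keys P. fscale (Poly_Mapping.lookup P m) (homogeneous_component n (?v m)))"
    by (simp add: free.poly_value_def homogeneous_component_sum homogeneous_component_fscale)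
  also have "\<dots> = (\<Sum>m\<in>Poly_Mapping.keys P. fscale (Poly_Mapping.lookup (weight_part n P) m) (?v m))"
    by (intro sum.cong) (auto simp: * lookup_weight_part)
  also have "\<dots> = free.poly_value leading_component (weight_part n P)"
    by (rule free.poly_value_superset[symmetric]) (auto simp: keys_weight_part)
  finally show ?thesis .
qed

text \<open>
  By \<open>monomial_value_leading_component\<close>, replacing each substituted polynomial by its leading component
  alters the value of a monomial only in degrees below its weight.
\<close>

lemma poly_value_top_weight:
  assumes "\<And>m. m \<in> Poly_Mapping.keys P \<Longrightarrow> weight m \<le> n"
  shows "free.poly_value (\<lambda>p. p) P \<in> degree_le n"
    and "homogeneous_component n (free.poly_value (\<lambda>p. p) P) =
      free.poly_value leading_component (weight_part n P)"
proof -
  let ?u = "free.monomial_value (\<lambda>p. p)" and ?v = "free.monomial_value leading_component"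
  have u: "?u m \<in> degree_le n" if "m \<in> Poly_Mapping.keys P" for m
    using monomial_value_degree_le degree_le_mono assms[OF that] by blast
  then show "free.poly_value (\<lambda>p. p) P \<in> degree_le n"
    unfolding free.poly_value_def
    by (intro free.subspace_sum free.subspace_scale subspace_degree_le)
  have *: "homogeneous_component n (?u m) = (if weight m = n then ?v m else 0)"
    if "m \<in> Poly_Mapping.keys P" for m
    using assms[OF that] homogeneous_component_above[OF monomial_value_degree_le, of m n]
    by (auto simp: monomial_value_leading_component)
  have "homogeneous_component n (free.poly_value (\<lambda>p. p) P) =
      (\<Sum>m\<in>Poly_Mapping.keys P. fscale (Poly_Mapping.lookup P m) (homogeneous_component n (?u m)))"
    by (simp add: free.poly_value_def homogeneous_component_sum homogeneous_component_fscale)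
  also have "\<dots> = (\<Sum>m\<in>Poly_Mapping.keys P. fscale (Poly_Mapping.lookup (weight_part n P) m) (?v m))"
    by (intro sum.cong) (auto simp: * lookup_weight_part)
  also have "\<dots> = free.poly_value leading_component (weight_part n P)"
    by (rule free.poly_value_superset[symmetric]) (auto simp: keys_weight_part)
  finally show "homogeneous_component n (free.poly_value (\<lambda>p. p) P) =
      free.poly_value leading_component (weight_part n P)" .
qed

text \<open>
  If the top weight \<open>k\<close> exceeded the degree of the value, the part of weight \<open>k\<close> would be a nontrivial
  relation between the leading components: there is no cancellation at the top.
\<close>

lemma weight_le_if_leading_independent:
  assumes ind: "\<And>Q. Q \<in> free_algebra B \<Longrightarrow> free.poly_value leading_component Q = 0 \<Longrightarrow> Q = 0"
    and P: "P \<in> free_algebra B" and val: "free.poly_value (\<lambda>p. p) P \<in> degree_le n"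
    and m: "m \<in> Poly_Mapping.keys P"
  shows "weight m \<le> n"
proof (rule ccontr)
  assume "\<not> weight m \<le> n"
  define k where "k = Max (weight ` Poly_Mapping.keys P)"
  have le: "weight m \<le> k" if "m \<in> Poly_Mapping.keys P" for m
    using that by (simp add: k_def)
  have "n < k" using le[OF m] \<open>\<not> _\<close> by simp
  have "free.poly_value leading_component (weight_part k P) =
      homogeneous_component k (free.poly_value (\<lambda>p. p) P)"
    using poly_value_top_weight(2)[OF le] by simp
  also have "\<dots> = 0" using homogeneous_component_above[OF val \<open>n < k\<close>] .
  finally have "weight_part k P = 0" using ind weight_part_in_free_algebra[OF P] by blast
  have "weight ` Poly_Mapping.keys P \<noteq> {}" using m by blast
  then have "k \<in> weight ` Poly_Mapping.keys P" unfolding k_def by (intro Max_in) simp_all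
  then have "Poly_Mapping.keys (weight_part k P) \<noteq> {}" by (auto simp only: keys_weight_part)
  then show False using \<open>weight_part k P = 0\<close> by simp
qed

section \<open>Initial parts of a subalgebra\<close>

text \<open>
  These are the homogeneous pieces of the associated graded algebra of \<open>S\<close>.  Taking all of
  \<open>S \<inter> degree_le n\<close>, and not only the elements of degree exactly \<open>n\<close>, puts \<open>0\<close> into every piece.
\<close>

definition initial_part :: "('a magma \<Rightarrow>\<^sub>0 'f::field) set \<Rightarrow> nat \<Rightarrow> ('a magma \<Rightarrow>\<^sub>0 'f) set" where
  "initial_part S n = homogeneous_component n ` (S \<inter> degree_le n)"

text \<open>
  Both factors have positive degree, hence also degree less than \<open>n\<close>; inductions on the degree rely on
  this.
\<close>

definition initial_products :: "('a magma \<Rightarrow>\<^sub>0 'f::field) set \<Rightarrow> nat \<Rightarrow> ('a magma \<Rightarrow>\<^sub>0 'f) set" where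
  "initial_products S n =
    {fmult a b | a b i j. a \<in> initial_part S i \<and> b \<in> initial_part S j \<and> 0 < i \<and> 0 < j \<and> i + j = n}"

text \<open>
  Linear independence, modulo the span of the products, of the family of leading components in each
  degree.  Distinct elements with the same leading component are excluded as well, since the index
  \<open>b\<close>, and not the vector \<open>leading_component b\<close>, is removed on the right.
\<close>

definition reduced :: "('a magma \<Rightarrow>\<^sub>0 'f::field) set \<Rightarrow> ('a magma \<Rightarrow>\<^sub>0 'f) set \<Rightarrow> bool" where
  "reduced S B \<longleftrightarrow> (\<forall>b\<in>B. leading_component b \<notin> free.span
    (initial_products S (poly_degree b) \<union>
      leading_component ` {b' \<in> B. poly_degree b' = poly_degree b \<and> b' \<noteq> b}))"

definition exhausting :: "('a magma \<Rightarrow>\<^sub>0 'f::field) set \<Rightarrow> ('a magma \<Rightarrow>\<^sub>0 'f) set \<Rightarrow> bool" where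
  "exhausting S B \<longleftrightarrow> (\<forall>n. initial_part S n \<subseteq>
    free.span (initial_products S n \<union> leading_component ` {b \<in> B. poly_degree b = n}))"

lemma initial_products_subset:
  assumes "free.subalgebra S"
  shows "initial_products S n \<subseteq> initial_part S n"
proof
  fix x assume "x \<in> initial_products S n"
  then obtain a b i j where "a \<in> initial_part S i" "b \<in> initial_part S j" "i + j = n" "x = fmult a b"
    unfolding initial_products_def by blast
  moreover from this obtain p q where "p \<in> S" "p \<in> degree_le i" "a = homogeneous_component i p"
    "q \<in> S" "q \<in> degree_le j" "b = homogeneous_component j q"
    unfolding initial_part_def by blast
  ultimately have "fmult p q \<in> S" "fmult p q \<in> degree_le n" "x = homogeneous_component n (fmult p q)"
    using assms fmult_degree_le[of p i q j] homogeneous_component_fmult[of p i q j]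
    by (simp_all add: free.subalgebra_def)
  then show "x \<in> initial_part S n" unfolding initial_part_def by blast
qed

lemma monomial_value_in_initial_part:
  assumes "free.subalgebra S" "B \<subseteq> S" "gens m \<subseteq> B"
  shows "free.monomial_value leading_component m \<in> initial_part S (weight m)"
proof -
  have "free.monomial_value (\<lambda>p. p) m \<in> S"
    using free.monomial_value_in_subalgebra[OF assms(1,3), of "\<lambda>p. p"] assms(2) by auto
  then show ?thesis
    unfolding initial_part_def monomial_value_leading_component
    using monomial_value_degree_le[of m] by (intro imageI) simp
qed

lemma monomial_value_Mul_in_initial_products:
  assumes "free.subalgebra S" "B \<subseteq> S" "0 \<notin> B" "gens (Mul k l) \<subseteq> B"
  shows "free.monomial_value leading_component (Mul k l) \<in> initial_products S (weight (Mul k l))"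
proof -
  have "gens k \<subseteq> B" "gens l \<subseteq> B" using assms(4) by auto
  then have "free.monomial_value leading_component k \<in> initial_part S (weight k)"
    "free.monomial_value leading_component l \<in> initial_part S (weight l)"
    "0 < weight k" "0 < weight l"
    using monomial_value_in_initial_part[OF assms(1,2)] weight_pos[OF _ assms(3)] by blast+
  then show ?thesis
    unfolding initial_products_def free.monomial_value.simps weight.simps by blast
qed

section \<open>Reduced sets are independent\<close>

text \<open>
  A coefficient of the sum at \<open>Mul m n\<close> only sees the coefficient of the left factors at \<open>m\<close> and that of
  the right factors at \<open>n\<close>.  For fixed \<open>m\<close> this is a linear relation between the \<open>v j\<close>; its coefficients
  vanish, and as \<open>m\<close> varies they express a linear relation between the \<open>u i\<close>.
\<close>

lemma fmult_tensor_injective: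
  fixes u :: "'i \<Rightarrow> ('a magma \<Rightarrow>\<^sub>0 'f::field)" and v :: "'j \<Rightarrow> ('a magma \<Rightarrow>\<^sub>0 'f)"
  assumes u: "\<And>d i. (\<Sum>i\<in>I. fscale (d i) (u i)) = 0 \<Longrightarrow> i \<in> I \<Longrightarrow> d i = 0"
    and v: "\<And>d j. (\<Sum>j\<in>J. fscale (d j) (v j)) = 0 \<Longrightarrow> j \<in> J \<Longrightarrow> d j = 0"
    and sum: "(\<Sum>i\<in>I. \<Sum>j\<in>J. fscale (c i j) (fmult (u i) (v j))) = 0"
    and "i \<in> I" "j \<in> J"
  shows "c i j = 0"
proof -
  have "(\<Sum>i\<in>I. c i j * Poly_Mapping.lookup (u i) m) = 0" for m
  proof (rule v[OF _ \<open>j \<in> J\<close>])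
    show "(\<Sum>j\<in>J. fscale (\<Sum>i\<in>I. c i j * Poly_Mapping.lookup (u i) m) (v j)) = 0"
    proof (rule poly_mapping_eqI)
      fix n
      have "Poly_Mapping.lookup (\<Sum>j\<in>J. fscale (\<Sum>i\<in>I. c i j * Poly_Mapping.lookup (u i) m) (v j)) n =
          (\<Sum>i\<in>I. \<Sum>j\<in>J. c i j * (Poly_Mapping.lookup (u i) m * Poly_Mapping.lookup (v j) n))"
        by (subst sum.swap) (simp add: lookup_sum lookup_fscale sum_distrib_right mult.assoc)
      also have "\<dots> = Poly_Mapping.lookup (\<Sum>i\<in>I. \<Sum>j\<in>J. fscale (c i j) (fmult (u i) (v j))) (Mul m n)"
        by (simp add: lookup_sum lookup_fscale lookup_fmult_Mul)
      finally show "Poly_Mapping.lookup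
          (\<Sum>j\<in>J. fscale (\<Sum>i\<in>I. c i j * Poly_Mapping.lookup (u i) m) (v j)) n = Poly_Mapping.lookup 0 n"
        by (simp add: sum)
    qed
  qed
  then have "(\<Sum>i\<in>I. fscale (c i j) (u i)) = 0"
    by (intro poly_mapping_eqI) (simp add: lookup_sum lookup_fscale)
  then show ?thesis by (rule u[OF _ \<open>i \<in> I\<close>])
qed

text \<open>
  In a homogeneous relation, every monomial that is a product takes a value in \<open>initial_products\<close>.  If \<open>b\<close>
  occurred linearly, one could solve for its leading component, which \<open>reduced\<close> forbids.
\<close>

lemma lookup_Gen_eq_0_if_reduced:
  assumes S: "free.subalgebra S" and B: "B \<subseteq> S" "0 \<notin> B" and red: "reduced S B"
    and P: "P \<in> free_algebra B" "free.poly_value leading_component P = 0"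
    and wt: "\<And>m. m \<in> Poly_Mapping.keys P \<Longrightarrow> weight m = n"
  shows "Poly_Mapping.lookup P (Gen b) = 0"
proof (rule ccontr)
  let ?v = "free.monomial_value leading_component"
  assume c: "Poly_Mapping.lookup P (Gen b) \<noteq> 0"
  then have key: "Gen b \<in> Poly_Mapping.keys P" by (simp add: in_keys_iff)
  then have "b \<in> B" using free_algebraD[OF P(1) key] by simp
  have n: "poly_degree b = n" using wt[OF key] by simp
  define R where "R = free.span (initial_products S n \<union>
      leading_component ` {b' \<in> B. poly_degree b' = n \<and> b' \<noteq> b})"
  have R: "?v m \<in> R" if m: "m \<in> Poly_Mapping.keys P - {Gen b}" for m
  proof -
    have mB: "gens m \<subseteq> B" using m free_algebraD[OF P(1)] by blast
    show ?thesis
    proof (cases m)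
      case (Gen b')
      then show ?thesis using m mB wt[of m] by (auto simp: R_def intro!: free.span_base)
    next
      case (Mul k l)
      then have "?v m \<in> initial_products S n"
        using monomial_value_Mul_in_initial_products[OF S B, of k l] mB wt[of m] m by simp
      then show ?thesis unfolding R_def by (intro free.span_base) simp
    qed
  qed
  define r where "r = (\<Sum>m\<in>Poly_Mapping.keys P - {Gen b}. fscale (Poly_Mapping.lookup P m) (?v m))"
  have "r \<in> R"
    unfolding r_def R_def using R by (intro free.span_sum free.span_scale) (simp add: R_def)
  have "fscale (Poly_Mapping.lookup P (Gen b)) (leading_component b) + r = 0"
    using P(2) sum.remove[OF finite_keys key, of "\<lambda>m. fscale (Poly_Mapping.lookup P m) (?v m)"]
    unfolding free.poly_value_def r_def by simp
  then have "fscale (Poly_Mapping.lookup P (Gen b)) (leading_component b) = - r"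
    by (simp only: eq_neg_iff_add_eq_0)
  moreover have "- r \<in> R"
    using \<open>r \<in> R\<close> unfolding R_def by (rule free.span_neg)
  ultimately have "fscale (inverse (Poly_Mapping.lookup P (Gen b)))
      (fscale (Poly_Mapping.lookup P (Gen b)) (leading_component b)) \<in> R"
    unfolding R_def by (simp only: free.span_scale)
  then have "leading_component b \<in> R" using c by simp
  then show False using red \<open>b \<in> B\<close> n unfolding reduced_def R_def by blast
qed

text \<open>
  Strong induction on a bound \<open>n\<close> for the weights in \<open>P\<close>.  The part \<open>Q\<close> of weight \<open>n\<close> is again a
  relation and contains only products \<open>Mul i j\<close>.  By the induction hypothesis the values of the factors
  \<open>i\<close>, and likewise those of the factors \<open>j\<close>, are linearly independent because their weights are smaller
  than \<open>n\<close>.  Injectivity of the product then shows that \<open>Q\<close> vanishes, and the weights in \<open>P\<close> are bounded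
  by \<open>n - 1\<close>.
\<close>

lemma leading_independent_if_reduced:
  assumes S: "free.subalgebra S" and B: "B \<subseteq> S" "0 \<notin> B" and red: "reduced S B"
    and "P \<in> free_algebra B" "free.poly_value leading_component P = 0"
  shows "P = 0"
proof -
  let ?v = "free.monomial_value leading_component"
  have "P = 0" if "P \<in> free_algebra B" "free.poly_value leading_component P = 0"
    "\<And>m. m \<in> Poly_Mapping.keys P \<Longrightarrow> weight m \<le> n" for n P
    using that
  proof (induction n arbitrary: P rule: less_induct)
    case (less n)
    define Q where "Q = weight_part n P"
    have Q: "Q \<in> free_algebra B" "free.poly_value leading_component Q = 0"
      using less.prems homogeneous_component_poly_value_leading[of n P]
      by (auto simp: Q_def weight_part_in_free_algebra homogeneous_component_0)
    have wt: "weight m = n" if "m \<in> Poly_Mapping.keys Q" for m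
      using that by (simp add: Q_def keys_weight_part)
    have noGen: "Gen b \<notin> Poly_Mapping.keys Q" for b
      using lookup_Gen_eq_0_if_reduced[OF S B red Q wt] by (simp add: in_keys_iff)
    \<comment> \<open>A linear relation between values of monomials is a formal polynomial in the kernel.\<close>
    have indep: "d i = 0"
      if I: "finite I" "\<And>i. i \<in> I \<Longrightarrow> gens i \<subseteq> B \<and> weight i < n"
        and d: "(\<Sum>i\<in>I. fscale (d i) (?v i)) = 0" and "i \<in> I" for I d i
    proof -
      define R where "R = (\<Sum>i\<in>I. Poly_Mapping.single i (d i))"
      have lookup: "Poly_Mapping.lookup R i = (if i \<in> I then d i else 0)" for i
        using I(1) by (simp add: R_def lookup_sum lookup_single when_def)
      then have keys: "Poly_Mapping.keys R \<subseteq> I" by (auto simp: in_keys_iff split: if_splits)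
      have "n > 0" using I(2)[OF \<open>i \<in> I\<close>] by simp
      have "R = 0"
      proof (rule less.IH[of "n - 1"])
        show "n - 1 < n" using \<open>n > 0\<close> by simp
        show "R \<in> free_algebra B" using keys I(2) unfolding free_algebra_def by blast
        show "free.poly_value leading_component R = 0"
          using d by (simp add: R_def free.poly_value_sum free.poly_value_single)
        show "weight m \<le> n - 1" if "m \<in> Poly_Mapping.keys R" for m
        proof -
          have "weight m < n" using I(2) keys that by blast
          then show ?thesis by simp
        qed
      qed
      then show ?thesis using lookup[of i] \<open>i \<in> I\<close> by simp
    qed
    \<comment> \<open>The left and the right factors; generators do not occur in \<open>Q\<close>, so that case is a dummy.\<close>
    define I where "I = (\<lambda>m. case m of Mul k l \<Rightarrow> k | Gen b \<Rightarrow> m) ` Poly_Mapping.keys Q"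
    define J where "J = (\<lambda>m. case m of Mul k l \<Rightarrow> l | Gen b \<Rightarrow> m) ` Poly_Mapping.keys Q"
    have fin: "finite I" "finite J" by (simp_all add: I_def J_def)
    have IJ: "\<exists>k l. m = Mul k l \<and> k \<in> I \<and> l \<in> J" if "m \<in> Poly_Mapping.keys Q" for m
    proof (cases m)
      case (Gen b)
      then show ?thesis using that noGen by simp
    next
      case (Mul k l)
      then show ?thesis using that unfolding I_def J_def by (auto intro!: image_eqI[OF _ that])
    qed
    have mul: "gens k \<subseteq> B \<and> weight k < n \<and> gens l \<subseteq> B \<and> weight l < n"
      if "Mul k l \<in> Poly_Mapping.keys Q" for k l
    proof -
      have "gens k \<subseteq> B" "gens l \<subseteq> B" using free_algebraD[OF Q(1) that] by simp_all
      moreover have "weight k + weight l = n" using wt[OF that] by simp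
      ultimately show ?thesis using weight_pos[OF _ B(2), of k] weight_pos[OF _ B(2), of l] by simp
    qed
    have I: "gens i \<subseteq> B \<and> weight i < n" if mem: "i \<in> I" for i
    proof -
      obtain m where "i = (case m of Mul k l \<Rightarrow> k | Gen b \<Rightarrow> m)" "m \<in> Poly_Mapping.keys Q"
        using mem unfolding I_def by (rule imageE)
      then show ?thesis using noGen mul by (cases m) simp_all
    qed
    have J: "gens j \<subseteq> B \<and> weight j < n" if mem: "j \<in> J" for j
    proof -
      obtain m where "j = (case m of Mul k l \<Rightarrow> l | Gen b \<Rightarrow> m)" "m \<in> Poly_Mapping.keys Q"
        using mem unfolding J_def by (rule imageE)
      then show ?thesis using noGen mul by (cases m) simp_all
    qed
    have "(\<Sum>i\<in>I. \<Sum>j\<in>J. fscale (Poly_Mapping.lookup Q (Mul i j)) (fmult (?v i) (?v j))) =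
        (\<Sum>(i, j)\<in>I \<times> J. fscale (Poly_Mapping.lookup Q (Mul i j)) (?v (Mul i j)))"
      by (simp add: sum.cartesian_product)
    also have "\<dots> = (\<Sum>m\<in>(\<lambda>(i, j). Mul i j) ` (I \<times> J). fscale (Poly_Mapping.lookup Q m) (?v m))"
      by (subst sum.reindex) (auto simp: inj_on_def case_prod_beta)
    also have "\<dots> = free.poly_value leading_component Q"
    proof (rule free.poly_value_superset[symmetric])
      show "finite ((\<lambda>(i, j). Mul i j) ` (I \<times> J))" using fin by simp
      show "Poly_Mapping.keys Q \<subseteq> (\<lambda>(i, j). Mul i j) ` (I \<times> J)" using IJ by fastforce
    qed
    also have "\<dots> = 0" by (fact Q(2))
    finally have zero:
      "(\<Sum>i\<in>I. \<Sum>j\<in>J. fscale (Poly_Mapping.lookup Q (Mul i j)) (fmult (?v i) (?v j))) = 0" .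
    have dI: "d i = 0" if "(\<Sum>i\<in>I. fscale (d i) (?v i)) = 0" "i \<in> I" for d i
      by (rule indep[OF fin(1) I that])
    have dJ: "d j = 0" if "(\<Sum>j\<in>J. fscale (d j) (?v j)) = 0" "j \<in> J" for d j
      by (rule indep[OF fin(2) J that])
    have "Poly_Mapping.lookup Q (Mul i j) = 0" if "i \<in> I" "j \<in> J" for i j
      by (rule fmult_tensor_injective[OF _ _ zero that]) (fact dI, fact dJ)
    then have keysQ: "m \<notin> Poly_Mapping.keys Q" for m
      using IJ[of m] unfolding in_keys_iff by blast
    then have lt: "weight m < n" if "m \<in> Poly_Mapping.keys P" for m
    proof -
      have "weight m \<noteq> n" using that keysQ[of m] by (simp add: Q_def keys_weight_part)
      then show ?thesis using less.prems(3)[OF that] by simp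
    qed
    show "P = 0"
    proof (rule ccontr)
      assume "P \<noteq> 0"
      then obtain m where "m \<in> Poly_Mapping.keys P" by (meson keys_eq_empty all_not_in_conv)
      then have "n - 1 < n" using lt[of m] by simp
      moreover have "weight m \<le> n - 1" if "m \<in> Poly_Mapping.keys P" for m using lt[OF that] by simp
      ultimately show False using less.IH[of "n - 1" P] less.prems(1,2) \<open>P \<noteq> 0\<close> by simp
    qed
  qed
  from this[OF assms(5,6), of "Max (weight ` Poly_Mapping.keys P)"] show ?thesis by simp
qed

lemma algebraically_independent_if_reduced:
  assumes "free.subalgebra S" "B \<subseteq> S" "0 \<notin> B" "reduced S B"
  shows "free.algebraically_independent B"
proof -
  have ind: "Q = 0" if "Q \<in> free_algebra B" "free.poly_value leading_component Q = 0" for Q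
    using leading_independent_if_reduced[OF assms that] .
  have "P = 0" if P: "P \<in> free_algebra B" "free.poly_value (\<lambda>p. p) P = 0" for P
  proof -
    \<comment> \<open>The value \<open>0\<close> has degree at most \<open>0\<close>, whereas every monomial over \<open>B\<close> has positive weight.\<close>
    have "weight m \<le> 0" if "m \<in> Poly_Mapping.keys P" for m
      using weight_le_if_leading_independent[OF ind P(1) _ that, of 0] P(2) by (simp add: degree_le_0)
    moreover have "0 < weight m" if "m \<in> Poly_Mapping.keys P" for m
      using weight_pos[OF free_algebraD[OF P(1) that] assms(3)] .
    ultimately have "m \<notin> Poly_Mapping.keys P" for m by (metis leD)
    then show ?thesis by (intro poly_mapping_eqI) (simp add: in_keys_iff)
  qed
  then show ?thesis
    using free.algebraically_independent_image_iff[of "\<lambda>p. p" B] by simp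
qed

section \<open>Exhausting sets generate\<close>

text \<open>
  Induction on the degree.  By the induction hypothesis the generated subalgebra has the same initial
  parts as \<open>S\<close> below \<open>n\<close>, so its initial part in degree \<open>n\<close> contains all products as well as the leading
  components of \<open>B\<close>.  Hence every \<open>p\<close> of degree at most \<open>n\<close> agrees in degree \<open>n\<close> with an element of the
  generated subalgebra, and the difference has smaller degree.
\<close>

lemma generated_if_exhausting:
  assumes S: "free.subalgebra S" and B: "B \<subseteq> S" and exh: "exhausting S B"
  shows "free.generated B = S"
proof
  let ?G = "free.generated B"
  show "?G \<subseteq> S" using B S by (rule free.generated_minimal)
  have G: "free.subalgebra ?G" by (rule free.subalgebra_generated)
  have "p \<in> ?G" if "p \<in> S" "p \<in> degree_le n" for n p
    using that
  proof (induction n arbitrary: p rule: less_induct)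
    case (less n)
    \<comment> \<open>\<open>less.IH\<close> says that the elements of \<open>S\<close> of degree at most \<open>i\<close> are generated, for all \<open>i < n\<close>.\<close>
    have lower: "initial_part S i \<subseteq> initial_part ?G i" if "i < n" for i
      using less.IH[OF that] by (auto simp: initial_part_def)
    have space: "free.subspace (initial_part ?G n)"
      unfolding initial_part_def free.subspace_def
    proof (intro conjI ballI allI)
      have sub: "free.subspace (?G \<inter> degree_le n)"
        using G subspace_degree_le by (intro free.subspace_inter) (auto simp: free.subalgebra_def)
      show "0 \<in> homogeneous_component n ` (?G \<inter> degree_le n)"
        using free.subspace_0[OF sub] homogeneous_component_0 by (metis image_eqI)
      fix x assume x: "x \<in> homogeneous_component n ` (?G \<inter> degree_le n)"
      show "x + y \<in> homogeneous_component n ` (?G \<inter> degree_le n)"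
        if "y \<in> homogeneous_component n ` (?G \<inter> degree_le n)" for y
        using x that free.subspace_add[OF sub] by (smt (verit) homogeneous_component_add image_iff)
      show "fscale c x \<in> homogeneous_component n ` (?G \<inter> degree_le n)" for c
        using x free.subspace_scale[OF sub] by (smt (verit) homogeneous_component_fscale image_iff)
    qed
    have "initial_products S n \<subseteq> initial_products ?G n"
    proof
      fix x assume "x \<in> initial_products S n"
      then obtain a b i j where ab: "x = fmult a b" "a \<in> initial_part S i" "b \<in> initial_part S j"
        "0 < i" "0 < j" "i + j = n"
        unfolding initial_products_def by blast
      then have "a \<in> initial_part ?G i" "b \<in> initial_part ?G j"
        using lower[of i] lower[of j] by auto
      then show "x \<in> initial_products ?G n" using ab unfolding initial_products_def by blast
    qed
    then have "initial_products S n \<subseteq> initial_part ?G n"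
      using initial_products_subset[OF G] by blast
    moreover have "leading_component ` {b \<in> B. poly_degree b = n} \<subseteq> initial_part ?G n"
      using free.generated_superset[of B] degree_le_poly_degree
      by (auto simp: initial_part_def leading_component_def intro!: imageI)
    ultimately have "free.span (initial_products S n \<union> leading_component ` {b \<in> B. poly_degree b = n})
        \<subseteq> initial_part ?G n"
      using space by (intro free.span_minimal) auto
    moreover have "homogeneous_component n p \<in> initial_part S n"
      using less.prems by (auto simp: initial_part_def)
    ultimately have "homogeneous_component n p \<in> initial_part ?G n"
      using exh unfolding exhausting_def by blast
    then obtain q where q: "q \<in> ?G" "q \<in> degree_le n"
      "homogeneous_component n p = homogeneous_component n q" by (auto simp: initial_part_def)
    have diff: "p - q \<in> S"
      using q(1) less.prems(1) \<open>?G \<subseteq> S\<close> S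
      by (auto simp: free.subalgebra_def intro: free.subspace_diff)
    have "p - q \<in> degree_le n"
      using subspace_degree_le less.prems(2) q(2) by (rule free.subspace_diff)
    moreover have "homogeneous_component n (p - q) = 0"
      using q(3) by (simp add: homogeneous_component_diff)
    ultimately have pred: "p - q \<in> degree_le (n - 1)" by (rule degree_le_pred)
    have "p - q \<in> ?G"
    proof (cases "n = 0")
      case True
      then have "p - q = 0" using pred by (simp add: degree_le_0)
      then show ?thesis using G by (simp add: free.subalgebra_def free.subspace_def)
    next
      case False
      then show ?thesis using less.IH[of "n - 1"] diff pred by simp
    qed
    then have "(p - q) + q \<in> ?G"
      using q(1) G unfolding free.subalgebra_def free.subspace_def by blast
    then show ?case by simp
  qed
  then show "S \<subseteq> ?G" using degree_le_poly_degree by blast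
qed

section \<open>Independent sets that generate the elements of low degree\<close>

text \<open>
  The independence of the leading components makes a formal polynomial with value of degree at most \<open>n\<close>
  have weight at most \<open>n\<close>; its part of weight \<open>n\<close> then evaluates to the component in question.
\<close>

lemma initial_part_poly_value:
  assumes ind: "\<And>P. P \<in> free_algebra B \<Longrightarrow> free.poly_value leading_component P = 0 \<Longrightarrow> P = 0"
    and low: "S \<inter> degree_le N \<subseteq> free.generated B" and "n \<le> N" and x: "x \<in> initial_part S n"
  obtains P where "P \<in> free_algebra B" "free.poly_value leading_component P = x"
    "\<And>m. m \<in> Poly_Mapping.keys P \<Longrightarrow> weight m = n"
proof -
  obtain p where p: "p \<in> S" "p \<in> degree_le n" "x = homogeneous_component n p"
    using x by (auto simp: initial_part_def)
  then have "p \<in> free.generated B" using low degree_le_mono[OF \<open>n \<le> N\<close>] by blast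
  then obtain P where P: "P \<in> free_algebra B" "p = free.poly_value (\<lambda>p. p) P"
    using free.generated_subset_poly_values by blast
  have "weight m \<le> n" if "m \<in> Poly_Mapping.keys P" for m
    using weight_le_if_leading_independent[OF ind P(1) _ that] p(2) P(2) by simp
  then have "free.poly_value leading_component (weight_part n P) = x"
    using poly_value_top_weight(2)[of P n] p(3) P(2) by simp
  then show ?thesis
    using that[of "weight_part n P"] weight_part_in_free_algebra[OF P(1)] by (auto simp: keys_weight_part)
qed

lemma initial_part_spanned:
  assumes ind: "\<And>P. P \<in> free_algebra B \<Longrightarrow> free.poly_value leading_component P = 0 \<Longrightarrow> P = 0"
    and low: "S \<inter> degree_le N \<subseteq> free.generated B"
    and S: "free.subalgebra S" and B: "B \<subseteq> S" "0 \<notin> B" and "n \<le> N"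
  shows "initial_part S n \<subseteq>
    free.span (initial_products S n \<union> leading_component ` {b \<in> B. poly_degree b = n})"
proof
  fix x assume "x \<in> initial_part S n"
  then obtain P where P: "P \<in> free_algebra B" "free.poly_value leading_component P = x"
    "\<And>m. m \<in> Poly_Mapping.keys P \<Longrightarrow> weight m = n"
    using initial_part_poly_value[OF ind low \<open>n \<le> N\<close>] by blast
  let ?V = "initial_products S n \<union> leading_component ` {b \<in> B. poly_degree b = n}"
  have "free.monomial_value leading_component m \<in> ?V" if m: "m \<in> Poly_Mapping.keys P" for m
  proof (cases m)
    case (Gen b)
    then show ?thesis using m P(1) P(3)[OF m] by (auto simp: free_algebra_def)
  next
    case (Mul k l)
    have "gens m \<subseteq> B" using m free_algebraD[OF P(1)] by blast
    then show ?thesis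
      using monomial_value_Mul_in_initial_products[OF S B, of k l] P(3)[OF m] Mul by auto
  qed
  then show "x \<in> free.span ?V"
    unfolding P(2)[symmetric] free.poly_value_def
    by (intro free.span_sum free.span_scale free.span_base)
qed

text \<open>
  Up to degree \<open>N\<close>, a product of initial parts is the value of a formal product, in which no indeterminate
  occurs linearly.  So a representation of \<open>leading_component b\<close> by products and by other leading
  components would be a relation in which \<open>b\<close> still occurs linearly with coefficient \<open>1\<close>.
\<close>

lemma reduced_of_independent:
  fixes B :: "('a magma \<Rightarrow>\<^sub>0 'f::field) set"
  assumes ind: "\<And>P. P \<in> free_algebra B \<Longrightarrow> free.poly_value leading_component P = 0 \<Longrightarrow> P = 0"
    and low: "S \<inter> degree_le N \<subseteq> free.generated B"
    and deg: "\<And>b. b \<in> B \<Longrightarrow> poly_degree b \<le> N"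
  shows "reduced S B"
  unfolding reduced_def
proof (intro ballI notI)
  fix b assume b: "b \<in> B"
  let ?n = "poly_degree b"
  let ?X = "\<lambda>b'. Poly_Mapping.single (Gen b') 1 :: ('a magma \<Rightarrow>\<^sub>0 'f) magma \<Rightarrow>\<^sub>0 'f"
  \<comment> \<open>The formal polynomials in which \<open>b\<close> does not occur linearly.\<close>
  define F where "F = free_algebra B \<inter> {Q :: ('a magma \<Rightarrow>\<^sub>0 'f) magma \<Rightarrow>\<^sub>0 'f. Poly_Mapping.lookup Q (Gen b) = 0}"
  have subF: "free.subspace F"
    using free_algebra_subalgebra[of B] unfolding F_def
    by (intro free.subspace_inter) (auto simp: free.subalgebra_def free.subspace_def lookup_add lookup_fscale)
  interpret val: Vector_Spaces.linear fscale fscale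
    "free.poly_value leading_component :: (('a magma \<Rightarrow>\<^sub>0 'f) magma \<Rightarrow>\<^sub>0 'f) \<Rightarrow> _"
    by (rule free.poly_value_linear)
  have space: "free.subspace (free.poly_value leading_component ` F)"
    using subF by (rule val.subspace_image)
  have "initial_products S ?n \<subseteq> free.poly_value leading_component ` F"
  proof
    fix x assume "x \<in> initial_products S ?n"
    then obtain u v i j where uv: "x = fmult u v" "u \<in> initial_part S i" "v \<in> initial_part S j" "i + j = ?n"
      unfolding initial_products_def by blast
    then have "i \<le> N" "j \<le> N" using deg[OF b] by auto
    then obtain P Q where "P \<in> free_algebra B" "free.poly_value leading_component P = u"
      "Q \<in> free_algebra B" "free.poly_value leading_component Q = v"
      using initial_part_poly_value[OF ind low] uv(2,3) by metis
    then have "fmult P Q \<in> F" "free.poly_value leading_component (fmult P Q) = x"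
      using free_algebra_subalgebra[of B] uv(1)
      by (auto simp: F_def lookup_fmult_Gen free.poly_value_fmult free.subalgebra_def)
    then show "x \<in> free.poly_value leading_component ` F" by blast
  qed
  moreover have "leading_component b' \<in> free.poly_value leading_component ` F"
    if "b' \<in> B" "b' \<noteq> b" for b'
  proof (rule image_eqI)
    show "leading_component b' = free.poly_value leading_component (?X b')"
      by (simp add: free.poly_value_Gen)
    show "?X b' \<in> F" using that by (simp add: F_def free_algebra_def lookup_single)
  qed
  ultimately have "free.span (initial_products S ?n \<union>
      leading_component ` {b' \<in> B. poly_degree b' = ?n \<and> b' \<noteq> b}) \<subseteq> free.poly_value leading_component ` F"
    using space by (intro free.span_minimal) auto
  moreover assume "leading_component b \<in> free.span (initial_products S ?n \<union>
      leading_component ` {b' \<in> B. poly_degree b' = ?n \<and> b' \<noteq> b})"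
  ultimately obtain Q where Q: "Q \<in> F" "leading_component b = free.poly_value leading_component Q"
    by blast
  have "free.poly_value leading_component (?X b - Q) = 0"
    using Q(2) by (simp add: free.poly_value_diff free.poly_value_Gen)
  moreover have "?X b - Q \<in> free_algebra B"
    using Q(1) b free_algebra_subalgebra[of B]
    by (intro free.subspace_diff) (auto simp: free.subalgebra_def F_def free_algebra_def)
  ultimately have "?X b - Q = 0" using ind by blast
  then have "Poly_Mapping.lookup (?X b) (Gen b) = Poly_Mapping.lookup Q (Gen b)" by simp
  then show False using Q(1) by (simp add: F_def)
qed

section \<open>The extension\<close>

text \<open>
  A basis of \<open>L\<close> modulo \<open>span D\<close>, obtained by extending a basis of the span of \<open>D\<close>.
\<close>

lemma (in vector_space) relative_basis:
  assumes "D \<subseteq> L"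
  obtains T where "T \<subseteq> L" "L \<subseteq> span (D \<union> T)" "\<And>t. t \<in> T \<Longrightarrow> t \<notin> span (D \<union> (T - {t}))"
proof -
  obtain C where C: "C \<subseteq> D" "independent C" "D \<subseteq> span C"
    by (rule maximal_independent_subset)
  obtain C' where C': "C \<subseteq> C'" "C' \<subseteq> L" "independent C'" "L \<subseteq> span C'"
    by (rule maximal_independent_subset_extend[OF order_trans[OF C(1) assms] C(2)])
  show ?thesis
  proof (rule that[of "C' - C"])
    show "C' - C \<subseteq> L" using C' by blast
    have "C' \<subseteq> D \<union> (C' - C)" using C(1) by blast
    then show "L \<subseteq> span (D \<union> (C' - C))" using C'(4) span_mono[of C'] by blast
    fix t assume t: "t \<in> C' - C"
    have "C \<subseteq> C' - {t}" using C'(1) t by blast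
    then have "D \<subseteq> span (C' - {t})" using C(3) span_mono[of C] by blast
    then have "span (D \<union> (C' - C - {t})) \<subseteq> span (C' - {t})"
      by (intro span_minimal subspace_span) (auto intro: span_base)
    then show "t \<notin> span (D \<union> (C' - C - {t}))"
      using C'(3) t unfolding dependent_def by blast
  qed
qed

text \<open>
  Both conditions concern each degree separately.  The new elements all have degree above \<open>N\<close>, where
  \<open>B\<close> has none, so the old degrees are untouched and the new ones can be filled by lifting relative bases.
\<close>

lemma reduced_exhausting_extension:
  assumes S: "free.subalgebra S" and B: "B \<subseteq> S" "0 \<notin> B"
    and deg: "\<And>b. b \<in> B \<Longrightarrow> poly_degree b \<le> N" and red: "reduced S B"
    and exh: "\<And>n. n \<le> N \<Longrightarrow> initial_part S n \<subseteq>
      free.span (initial_products S n \<union> leading_component ` {b \<in> B. poly_degree b = n})"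
  obtains C where "B \<subseteq> C" "C \<subseteq> S" "0 \<notin> C" "reduced S C" "exhausting S C"
proof -
  have "\<forall>n. \<exists>T. T \<subseteq> initial_part S n \<and> initial_part S n \<subseteq> free.span (initial_products S n \<union> T) \<and>
      (\<forall>t\<in>T. t \<notin> free.span (initial_products S n \<union> (T - {t})))" (is "\<forall>n. \<exists>T. ?basis n T")
  proof
    show "\<exists>T. ?basis n T" for n
      by (rule free.relative_basis[OF initial_products_subset[OF S, of n]]) blast
  qed
  then have "\<exists>T. \<forall>n. ?basis n (T n)" by (rule choice)
  then obtain T where basis: "\<forall>n. ?basis n (T n)" by (rule exE)
  from basis have T: "T n \<subseteq> initial_part S n"
    "initial_part S n \<subseteq> free.span (initial_products S n \<union> T n)"
    "t \<in> T n \<Longrightarrow> t \<notin> free.span (initial_products S n \<union> (T n - {t}))" for n t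
    by blast+
  define f where "f n t = (SOME p. p \<in> S \<and> p \<in> degree_le n \<and> homogeneous_component n p = t)" for n t
  have f: "f n t \<in> S \<and> f n t \<in> degree_le n \<and> homogeneous_component n (f n t) = t" if "t \<in> T n" for n t
  proof -
    have "\<exists>p. p \<in> S \<and> p \<in> degree_le n \<and> homogeneous_component n p = t"
      using T(1)[of n] that unfolding initial_part_def by blast
    then show ?thesis unfolding f_def by (rule someI_ex)
  qed
  \<comment> \<open>A basis vector is nonzero, so its lift has degree exactly \<open>n\<close> and the vector as leading component.\<close>
  have f0: "t \<noteq> 0" if "t \<in> T n" for n t
    using T(3)[OF that] free.span_zero by auto
  have fdeg: "poly_degree (f n t) = n" if "t \<in> T n" for n t
    using f[OF that] f0[OF that] poly_degree_eqI[of "f n t" n] by simp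
  have flead: "leading_component (f n t) = t" if "t \<in> T n" for n t
    using f[OF that] fdeg[OF that] by (simp add: leading_component_def)
  define C where "C = B \<union> (\<Union>n\<in>{N<..}. f n ` T n)"
  have low: "{b \<in> C. poly_degree b = n} = {b \<in> B. poly_degree b = n}" if "n \<le> N" for n
    using that fdeg by (auto simp: C_def)
  have high: "{b \<in> C. poly_degree b = n} = f n ` T n" if "N < n" for n
  proof
    show "{b \<in> C. poly_degree b = n} \<subseteq> f n ` T n"
    proof
      fix b assume b: "b \<in> {b \<in> C. poly_degree b = n}"
      then have "b \<notin> B" using deg[of b] that by auto
      then obtain k t where "t \<in> T k" "b = f k t" using b unfolding C_def by blast
      then show "b \<in> f n ` T n" using b fdeg[of t k] by simp
    qed
    show "f n ` T n \<subseteq> {b \<in> C. poly_degree b = n}"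
      using that fdeg by (auto simp: C_def)
  qed
  have lead: "leading_component ` f n ` T n = T n" for n
    using flead[of _ n] by (simp add: image_image)
  show ?thesis
  proof (rule that[of C])
    show "B \<subseteq> C" by (simp add: C_def)
    show "C \<subseteq> S" using B(1) f by (auto simp: C_def)
    show "0 \<notin> C"
    proof
      assume "0 \<in> C"
      then obtain n t where t: "t \<in> T n" "0 = f n t" using B(2) unfolding C_def by blast
      have "t = homogeneous_component n (f n t)" using f[OF t(1)] by simp
      also have "\<dots> = 0" unfolding t(2)[symmetric] by (rule homogeneous_component_0)
      finally show False using f0[OF t(1)] by simp
    qed
    show "exhausting S C"
      unfolding exhausting_def
    proof
      fix n
      show "initial_part S n \<subseteq>
          free.span (initial_products S n \<union> leading_component ` {b \<in> C. poly_degree b = n})"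
      proof (cases "n \<le> N")
        case True
        then show ?thesis unfolding low[OF True] by (rule exh)
      next
        case False
        then have "N < n" by simp
        then show ?thesis unfolding high[OF \<open>N < n\<close>] lead by (intro T(2))
      qed
    qed
    show "reduced S C"
      unfolding reduced_def
    proof
      fix b assume b: "b \<in> C"
      let ?n = "poly_degree b"
      have split: "{b' \<in> C. poly_degree b' = ?n \<and> b' \<noteq> b} = {b' \<in> C. poly_degree b' = ?n} - {b}" by auto
      show "leading_component b \<notin> free.span (initial_products S ?n \<union>
          leading_component ` {b' \<in> C. poly_degree b' = ?n \<and> b' \<noteq> b})"
      proof (cases "?n \<le> N")
        case True
        then have "b \<in> B" using b low[OF True] by blast
        moreover have "{b' \<in> C. poly_degree b' = ?n \<and> b' \<noteq> b} = {b' \<in> B. poly_degree b' = ?n \<and> b' \<noteq> b}"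
          using low[OF True] by blast
        ultimately show ?thesis using red unfolding reduced_def by simp
      next
        case False
        then have n: "N < ?n" by simp
        then obtain t where t: "t \<in> T ?n" "b = f ?n t" using b high[OF n] by blast
        have "leading_component ` {b' \<in> C. poly_degree b' = ?n \<and> b' \<noteq> b} \<subseteq> T ?n - {t}"
          unfolding split high[OF n] using flead t(2) by auto
        then have "free.span (initial_products S ?n \<union>
            leading_component ` {b' \<in> C. poly_degree b' = ?n \<and> b' \<noteq> b}) \<subseteq>
            free.span (initial_products S ?n \<union> (T ?n - {t}))"
          by (intro free.span_mono) blast
        moreover have "leading_component b = t" using flead[OF t(1)] t(2) by simp
        ultimately show ?thesis using T(3)[OF t(1)] by blast
      qed
    qed
  qed
qed

theorem theorem7:
  fixes A :: "'a set"
    and S \<alpha>\<^sub>S :: "('a magma \<Rightarrow>\<^sub>0 'f::field) set"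
  assumes "A \<noteq> {}"
    and "S \<subseteq> free_algebra A"
    and "free.subalgebra S"
    and "\<alpha>\<^sub>S \<subseteq> S"
    and "0 \<notin> \<alpha>\<^sub>S"
    and "free.algebraically_independent {leading_component p | p. p \<in> \<alpha>\<^sub>S}"
    and "\<forall>p\<^sub>1\<in>\<alpha>\<^sub>S. \<forall>p\<^sub>2\<in>\<alpha>\<^sub>S. p\<^sub>1 \<noteq> p\<^sub>2 \<longrightarrow> leading_component p\<^sub>1 \<noteq> leading_component p\<^sub>2"
    and "bounded_degree \<alpha>\<^sub>S"
    and "{p \<in> S. p \<noteq> 0 \<and> poly_degree p \<le> set_degree \<alpha>\<^sub>S} \<subseteq> free.generated \<alpha>\<^sub>S"
  shows "\<exists>\<alpha>. \<alpha> \<subseteq> S \<and> free.algebraically_independent \<alpha> \<and> \<alpha>\<^sub>S \<subseteq> \<alpha> \<and> free.generated \<alpha> = S"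
proof -
  let ?ld = "leading_component :: ('a magma \<Rightarrow>\<^sub>0 'f) \<Rightarrow> _"
  define N where "N = set_degree \<alpha>\<^sub>S"
  have deg: "poly_degree p \<le> N" if "p \<in> \<alpha>\<^sub>S" for p
  proof -
    obtain k where "degree_bound \<alpha>\<^sub>S k"
      using assms(8) unfolding bounded_degree_def by blast
    then have "degree_bound \<alpha>\<^sub>S (LEAST k. degree_bound \<alpha>\<^sub>S k)" by (rule LeastI)
    then show ?thesis
      using that assms(5) unfolding N_def set_degree_def degree_bound_def by auto
  qed
  have "inj_on ?ld \<alpha>\<^sub>S"
    using assms(7) by (meson inj_onI)
  moreover have "free.algebraically_independent (?ld ` \<alpha>\<^sub>S)"
    using assms(6) by (simp add: Setcompr_eq_image)
  ultimately have ind: "P = 0" if "P \<in> free_algebra \<alpha>\<^sub>S" "free.poly_value ?ld P = 0" for P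
    using that free.algebraically_independent_image_iff by blast
  have low: "S \<inter> degree_le N \<subseteq> free.generated \<alpha>\<^sub>S"
  proof
    fix p assume p: "p \<in> S \<inter> degree_le N"
    show "p \<in> free.generated \<alpha>\<^sub>S"
    proof (cases "p = 0")
      case True
      then show ?thesis
        using free.subalgebra_generated[of \<alpha>\<^sub>S] by (simp add: free.subalgebra_def free.subspace_def)
    next
      case False
      then have "poly_degree p \<le> N" using p by (auto intro: poly_degree_le)
      then show ?thesis using assms(9) p False unfolding N_def by blast
    qed
  qed
  have "reduced S \<alpha>\<^sub>S"
    using reduced_of_independent[OF ind low] deg assms(4) by blast
  moreover have "initial_part S n \<subseteq> free.span (initial_products S n \<union> ?ld ` {b \<in> \<alpha>\<^sub>S. poly_degree b = n})"
    if "n \<le> N" for n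
    using initial_part_spanned[OF ind low assms(3-5) that] .
  ultimately obtain \<alpha> where \<alpha>: "\<alpha>\<^sub>S \<subseteq> \<alpha>" "\<alpha> \<subseteq> S" "0 \<notin> \<alpha>" "reduced S \<alpha>" "exhausting S \<alpha>"
    using reduced_exhausting_extension[OF assms(3-5), of N] deg by blast
  have "free.algebraically_independent \<alpha>"
    using algebraically_independent_if_reduced[OF assms(3) \<alpha>(2-4)] .
  moreover have "free.generated \<alpha> = S"
    using generated_if_exhausting[OF assms(3) \<alpha>(2,5)] .
  ultimately show ?thesis using \<alpha>(1,2) by blast
qed

end
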